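(* Consider the PSPS scheduling problem with cost adjustment $$\min_{u_t,\ t=1,\dots,T}\ \mathbb{E}\big[c_{\mathrm a}(N,\mathbf{u})\big]\quad\text{subject to } u_t\in\{0,1\},\ u_0=u_{T+1}=0,$$ $$c_{\mathrm a}(N,\mathbf{u})=\sum_{t=1}^T\Big(a_{t+1}u_t+A_{t+1}f_{t+1}(\mathbf{X}_{t+1})(1-u_t)+\max\{s_{1,t+1}(u_t-u_{t-1}),\,s_{2,t+1}(u_{t-1}-u_t)\}\Big)+\lambda\Big(\sum_{t=1}^Tu_t-N\Big)+\overline{C}_I(N).$$ Its solution is given by the following (optimal) policy. On day $d=T-t$, after receiving the current observations $\mathbf{X}_d=\mathbf{x}$, $u_d=1$ if $$\mathbb{E}[f_{d-1}(\mathbf{X}_{d-1})\mid\mathbf{X}_d=\mathbf{x}]\ \ge\ \frac{1}{A_{d-1}}\Big(h_{d-1}(1,\mathbf{x})-h_{d-1}(0,\mathbf{x})+a_{d-1}+\lambda+(1-u_{d+1})s_{1,d-1}-u_{d+1}s_{2,d-1}\Big),$$ where $$h_d(u_{d+1}=u,\mathbf{X}_{d+1}=\mathbf{x})=\sum_{\boldsymbol{\xi}\in\mathcal{X}}\min\Big\{h_{d-1}(0,\boldsymbol{\xi})+\mathbb{E}[A_{d-1}f_{d-1}(\mathbf{X}_{d-1})\mid\mathbf{X}_d=\boldsymbol{\xi}]+u\,s_{2,d-1},\ h_{d-1}(1,\boldsymbol{\xi})+a_{d-1}+\lambda+(1-u)s_{1,d-1}\Big\}\Pr[\mathbf{X}_d=\boldsymbol{\xi}\mid\mathbf{X}_{d+1}=\mathbf{x}],$$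 with $$h_0(u,\mathbf{x})=\sum_{\boldsymbol{\xi}\in\mathcal{X}}\mathbb{E}[A_{T+1}f_{T+1}(\mathbf{X}_{T+1})\mid\mathbf{X}_T=\boldsymbol{\xi}]\Pr[\mathbf{X}_T=\boldsymbol{\xi}\mid\mathbf{X}_{T-1}=\mathbf{x}]+u\,s_{2,T+1}.$$
   Context: Days are $t=1,\dots,T$. $u_t=1$ is the decision, taken at day $t$, to call a public safety power shutoff (PSPS) for day $t+1$; $u_t=0$ is the decision to operate the grid normally; $\mathbf{u}=(u_1,\dots,u_T)$. The grid is assumed energized before and after the time range, i.e. $u_0=u_{T+1}=0$. $N$ is the number of budgeted PSPSs, $\lambda>0$ is the value of lost load for a day (the cost adjustment per PSPS above or below $N$), and $\overline{C}_I(N)$ is a given investment that does not depend on the decisions. $\mathbf{X}_t\in\mathbb{R}^n$ is a random vector of observations, observed at the end of day $t$; it is a discrete-time, finite-state Markov process with state space $\mathcal{X}\subset\mathbb{R}^n$ and known transition probabilities. The expectation is over the $\mathbf{X}_t$. $f_t:\mathbb{R}^n\to\{0,1\}$ is a known deterministic function indicating high (1) or low (0) ignition risk. $A_t>0$ is the estimated cost of powerline-caused wildfires, $a_t>0$ the revenue loss when de-energizing, and $s_{1,t}>0$, $s_{2,t}>0$ the costs of de-energizing and re-energizing the grid. Indexing: $d=T-t$ is the number of remaining days, and subscripts written with $d$ count remaining days (so $d-1$ is the day after $d$, and $u_{d+1}$ is the decision of the previous day). Subscripts written with $T$ ($T+1$, $T$, $T-1$) are calendar days.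
   Formalization: As printed the policy can fail, since u_T is free but h_0 has no minimum. Two repairs are proved: the printed h_0 and rule for d≥1 with the added constraint u_T=0; and the printed constraints with h_0 given by the recursion and the rule also used at d=0, with h_{-1}=0. *)

theory Defs
  imports "HOL-Probability.Probability"
begin

text \<open>
  Everything is indexed by calendar days. The decision \<open>u t\<close>, taken at day \<open>t\<close>, concerns day
  \<open>t + 1\<close>; the data of day \<open>t + 1\<close> (\<open>a, A, s\<^sub>1, s\<^sub>2, f\<close>) are attached to index \<open>t + 1\<close>.
  Decisions are real numbers in \<open>{0, 1}\<close>.
\<close>

record 's psps =
  horizon :: nat                              \<comment> \<open>\<open>T\<close>\<close>
  revenue_loss :: "nat \<Rightarrow> real"               \<comment> \<open>\<open>a\<close>\<close>
  fire_cost :: "nat \<Rightarrow> real"                  \<comment> \<open>\<open>A\<close>\<close>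
  deenergize_cost :: "nat \<Rightarrow> real"            \<comment> \<open>\<open>s\<^sub>1\<close>\<close>
  reenergize_cost :: "nat \<Rightarrow> real"            \<comment> \<open>\<open>s\<^sub>2\<close>\<close>
  lost_load :: real                           \<comment> \<open>\<open>\<lambda>\<close>\<close>
  budget :: nat                               \<comment> \<open>\<open>N\<close>\<close>
  investment :: "nat \<Rightarrow> real"                 \<comment> \<open>\<open>C\<^sub>I\<close>\<close>
  risk :: "nat \<Rightarrow> 's \<Rightarrow> real"                 \<comment> \<open>\<open>f\<close>\<close>

definition valid_psps :: "'s psps \<Rightarrow> bool" where
  "valid_psps P \<longleftrightarrow>
     horizon P \<ge> 1 \<and> lost_load P > 0 \<and>
     (\<forall>t\<in>{2..horizon P + 1}.
        revenue_loss P t > 0 \<and> fire_cost P t > 0 \<and>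
        deenergize_cost P t > 0 \<and> reenergize_cost P t > 0 \<and>
        (\<forall>x. risk P t x \<in> {0, 1}))"

definition finite_markov_process ::
  "'w measure \<Rightarrow> (nat \<Rightarrow> 'w \<Rightarrow> 's::topological_space) \<Rightarrow> 's set \<Rightarrow> nat \<Rightarrow> bool" where
  "finite_markov_process M X S n \<longleftrightarrow>
     finite S \<and>
     (\<forall>t\<in>{1..n}. X t \<in> borel_measurable M \<and> (\<forall>\<omega>\<in>space M. X t \<omega> \<in> S)) \<and>
     (\<forall>t\<in>{1..<n}. \<forall>x y.
        \<P>(\<omega> in M. \<forall>s\<in>{1..t}. X s \<omega> = x s) > 0 \<longrightarrow>
        \<P>(\<omega> in M. X (t + 1) \<omega> = y \<bar> \<forall>s\<in>{1..t}. X s \<omega> = x s) =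
        \<P>(\<omega> in M. X (t + 1) \<omega> = y \<bar> X t \<omega> = x t))"

text \<open>Expectation given an event; like \<^const>\<open>cond_prob\<close>, it is \<open>0\<close> if the event is null.\<close>

definition cond_expect :: "'w measure \<Rightarrow> ('w \<Rightarrow> real) \<Rightarrow> ('w \<Rightarrow> bool) \<Rightarrow> real" where
  "cond_expect M g Q = (\<integral>\<omega>. g \<omega> * of_bool (Q \<omega>) \<partial>M) / \<P>(\<omega> in M. Q \<omega>)"

definition adjusted_cost :: "'s psps \<Rightarrow> (nat \<Rightarrow> 'w \<Rightarrow> 's) \<Rightarrow> (nat \<Rightarrow> 'w \<Rightarrow> real) \<Rightarrow> 'w \<Rightarrow> real" where
  "adjusted_cost P X u \<omega> =
     (\<Sum>t=1..horizon P.
        revenue_loss P (t + 1) * u t \<omega>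
        + fire_cost P (t + 1) * risk P (t + 1) (X (t + 1) \<omega>) * (1 - u t \<omega>)
        + max (deenergize_cost P (t + 1) * (u t \<omega> - u (t - 1) \<omega>))
              (reenergize_cost P (t + 1) * (u (t - 1) \<omega> - u t \<omega>)))
     + lost_load P * ((\<Sum>t=1..horizon P. u t \<omega>) - real (budget P))
     + investment P (budget P)"

text \<open>
  The decision at day \<open>t\<close> may depend on the observations \<open>X 1, \<dots>, X t\<close> made so far, and on
  nothing else.
\<close>

definition admissible ::
  "'w measure \<Rightarrow> (nat \<Rightarrow> 'w \<Rightarrow> 's) \<Rightarrow> 's psps \<Rightarrow> (nat \<Rightarrow> 'w \<Rightarrow> real) \<Rightarrow> bool" where
  "admissible M X P u \<longleftrightarrow>
     (\<forall>\<omega>\<in>space M. u 0 \<omega> = 0 \<and> u (horizon P + 1) \<omega> = 0) \<and>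
     (\<forall>t\<in>{1..horizon P}.
        (\<forall>\<omega>\<in>space M. u t \<omega> \<in> {0, 1}) \<and>
        (\<forall>\<omega>\<in>space M. \<forall>\<omega>'\<in>space M. (\<forall>s\<in>{1..t}. X s \<omega> = X s \<omega>') \<longrightarrow> u t \<omega> = u t \<omega>'))"

text \<open>
  With \<open>u t\<close> acting on day \<open>t + 1\<close>, the grid is energized on the day \<open>T + 1\<close> after the time range
  iff \<open>u T = 0\<close>.
\<close>

definition energized_after :: "'w measure \<Rightarrow> 's psps \<Rightarrow> (nat \<Rightarrow> 'w \<Rightarrow> real) \<Rightarrow> bool" where
  "energized_after M P u \<longleftrightarrow> (\<forall>\<omega>\<in>space M. u (horizon P) \<omega> = 0)"

text \<open>
  One step of the backward recursion at day \<open>t\<close>, given the previous decision \<open>u\<close>, the previous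
  observation \<open>x\<close>, and the cost-to-go \<open>g\<close> of the days after \<open>t\<close>.
\<close>

definition dp_step ::
  "'w measure \<Rightarrow> (nat \<Rightarrow> 'w \<Rightarrow> 's) \<Rightarrow> 's set \<Rightarrow> 's psps \<Rightarrow> nat \<Rightarrow>
   (real \<Rightarrow> 's \<Rightarrow> real) \<Rightarrow> real \<Rightarrow> 's \<Rightarrow> real" where
  "dp_step M X S P t g u x =
     (\<Sum>\<xi>\<in>S.
        min (g 0 \<xi>
             + cond_expect M (\<lambda>\<omega>. fire_cost P (t + 1) * risk P (t + 1) (X (t + 1) \<omega>)) (\<lambda>\<omega>. X t \<omega> = \<xi>)
             + u * reenergize_cost P (t + 1))
            (g 1 \<xi> + revenue_loss P (t + 1) + lost_load P + (1 - u) * deenergize_cost P (t + 1))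
        * \<P>(\<omega> in M. X t \<omega> = \<xi> \<bar> X (t - 1) \<omega> = x))"

text \<open>
  \<open>cost_to_go M X S P b d\<close> is \<open>h\<^sub>d\<close>, where \<open>d\<close> counts the remaining days, so that \<open>d\<close> stands for
  the calendar day \<open>T - d\<close>, and \<open>b\<close> is \<open>h\<^sub>0\<close>.
\<close>

primrec cost_to_go ::
  "'w measure \<Rightarrow> (nat \<Rightarrow> 'w \<Rightarrow> 's) \<Rightarrow> 's set \<Rightarrow> 's psps \<Rightarrow> (real \<Rightarrow> 's \<Rightarrow> real) \<Rightarrow> nat \<Rightarrow>
   real \<Rightarrow> 's \<Rightarrow> real" where
  "cost_to_go M X S P b 0 = b"
| "cost_to_go M X S P b (Suc d) = dp_step M X S P (horizon P - Suc d) (cost_to_go M X S P b d)"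

definition h0_energized ::
  "'w measure \<Rightarrow> (nat \<Rightarrow> 'w \<Rightarrow> 's) \<Rightarrow> 's set \<Rightarrow> 's psps \<Rightarrow> real \<Rightarrow> 's \<Rightarrow> real" where
  "h0_energized M X S P u x = (let T = horizon P in
     (\<Sum>\<xi>\<in>S.
        cond_expect M (\<lambda>\<omega>. fire_cost P (T + 1) * risk P (T + 1) (X (T + 1) \<omega>)) (\<lambda>\<omega>. X T \<omega> = \<xi>)
        * \<P>(\<omega> in M. X T \<omega> = \<xi> \<bar> X (T - 1) \<omega> = x))
     + u * reenergize_cost P (T + 1))"

text \<open>
  \<open>h0_energized\<close> contains no minimum: it is the cost of the last stage when \<open>u T = 0\<close>. If \<open>u T\<close>
  is chosen freely, the last stage is an ordinary step of the recursion with nothing to follow.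
\<close>

definition h0_free ::
  "'w measure \<Rightarrow> (nat \<Rightarrow> 'w \<Rightarrow> 's) \<Rightarrow> 's set \<Rightarrow> 's psps \<Rightarrow> real \<Rightarrow> 's \<Rightarrow> real" where
  "h0_free M X S P = dp_step M X S P (horizon P) (\<lambda>_ _. 0)"

text \<open>The threshold rule at day \<open>t\<close>, with \<open>u\<close> the previous decision and \<open>x\<close> the current observation.\<close>

definition threshold_rule ::
  "'w measure \<Rightarrow> (nat \<Rightarrow> 'w \<Rightarrow> 's) \<Rightarrow> 's psps \<Rightarrow> nat \<Rightarrow> (real \<Rightarrow> 's \<Rightarrow> real) \<Rightarrow> real \<Rightarrow> 's \<Rightarrow> real" where
  "threshold_rule M X P t g u x =
     (if cond_expect M (\<lambda>\<omega>. risk P (t + 1) (X (t + 1) \<omega>)) (\<lambda>\<omega>. X t \<omega> = x)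
         \<ge> 1 / fire_cost P (t + 1) *
           (g 1 x - g 0 x + revenue_loss P (t + 1) + lost_load P
            + (1 - u) * deenergize_cost P (t + 1) - u * reenergize_cost P (t + 1))
      then 1 else 0)"

text \<open>
  On the day with \<open>d \<ge> 1\<close> remaining days the rule uses \<open>h\<^bsub>d-1\<^esub>\<close>. In the first policy there
  is nothing to decide on day \<open>T\<close>; in the second one, the rule is also used there, with no cost
  to go.
\<close>

primrec policy_energized ::
  "'w measure \<Rightarrow> (nat \<Rightarrow> 'w \<Rightarrow> 's) \<Rightarrow> 's set \<Rightarrow> 's psps \<Rightarrow> nat \<Rightarrow> 'w \<Rightarrow> real" where
  "policy_energized M X S P 0 \<omega> = 0"
| "policy_energized M X S P (Suc t) \<omega> =
     (if Suc t < horizon P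
      then threshold_rule M X P (Suc t)
             (cost_to_go M X S P (h0_energized M X S P) (horizon P - Suc t - 1))
             (policy_energized M X S P t \<omega>) (X (Suc t) \<omega>)
      else 0)"

primrec policy_free ::
  "'w measure \<Rightarrow> (nat \<Rightarrow> 'w \<Rightarrow> 's) \<Rightarrow> 's set \<Rightarrow> 's psps \<Rightarrow> nat \<Rightarrow> 'w \<Rightarrow> real" where
  "policy_free M X S P 0 \<omega> = 0"
| "policy_free M X S P (Suc t) \<omega> =
     (if Suc t < horizon P
      then threshold_rule M X P (Suc t)
             (cost_to_go M X S P (h0_free M X S P) (horizon P - Suc t - 1))
             (policy_free M X S P t \<omega>) (X (Suc t) \<omega>)
      else if Suc t = horizon P
      then threshold_rule M X P (Suc t) (\<lambda>_ _. 0) (policy_free M X S P t \<omega>) (X (Suc t) \<omega>)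
      else 0)"

end

theory Submission
  imports Defs
begin

text \<open>
  The proof writes the excess cost of a policy as a sum of one-day regrets.

  Fix functions \<open>g t v x\<close> (cost to go after day \<open>t\<close>, given decision \<open>v\<close> and observation \<open>x\<close>) and
  \<open>W t u x\<close> (value at day \<open>t\<close>, given the previous decision \<open>u\<close>) such that \<open>g t v x\<close> is the
  conditional expectation of \<open>W (t + 1) v (X (t + 1))\<close> given \<open>X t = x\<close>, and \<open>g\<close> vanishes on the last
  day. Let \<open>Q t v u x\<close> be the expected cost of day \<open>t\<close> plus \<open>g t v x\<close>. A decision is a function of
  the past observations, so the Markov property (\<open>markov_expectation\<close>) gives both
  \<open>E [g t (u t) (X t)] = E [W (t + 1) (u t) (X (t + 1))]\<close> and the replacement of the wildfire cost of
  day \<open>t + 1\<close> by its expectation given \<open>X t\<close> alone. Hence the sum over the days telescopes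
  (\<open>expected_cost_decomposition\<close>): up to a constant,
  the expected cost of every admissible policy \<open>u\<close> is
  \<open>E [W 1 0 (X 1)] + (\<Sum>t. E [Q t (u t) (u (t - 1)) (X t) - W t (u (t - 1)) (X t)])\<close>.
  The first term does not depend on \<open>u\<close>. When \<open>W t\<close> is the minimum of \<open>Q t\<close> over the decisions that
  are allowed on day \<open>t\<close>, each summand is nonnegative, and it vanishes for a policy that always picks
  a minimizer (\<open>optimal_if_greedy\<close>).

  The recursion for \<open>h\<close> is exactly this choice of \<open>g\<close> and \<open>W\<close>, and the threshold rule, solved for
  the conditional risk, says that shutting off costs at most as much as operating
  (\<open>threshold_rule_greedy\<close>). The two boundary conditions differ only on the last day: either both
  decisions are allowed there, or only \<open>0\<close> is.
\<close>

section \<open>Expectations of functions of finitely many observations\<close>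

lemma (in prob_space) expectation_finite_valued:
  fixes \<phi> :: "'k \<Rightarrow> real"
  assumes "finite K" and Z: "\<And>\<omega>. \<omega> \<in> space M \<Longrightarrow> Z \<omega> \<in> K"
    and ev: "\<And>k. k \<in> K \<Longrightarrow> {\<omega> \<in> space M. Z \<omega> = k} \<in> events"
  shows "integrable M (\<lambda>\<omega>. \<phi> (Z \<omega>))"
    and "(\<integral>\<omega>. \<phi> (Z \<omega>) \<partial>M) = (\<Sum>k\<in>K. \<phi> k * prob {\<omega> \<in> space M. Z \<omega> = k})"
proof -
  let ?ind = "\<lambda>k. indicator {\<omega> \<in> space M. Z \<omega> = k} :: 'a \<Rightarrow> real"
  have eq: "\<phi> (Z \<omega>) = (\<Sum>k\<in>K. \<phi> k * ?ind k \<omega>)" if "\<omega> \<in> space M" for \<omega>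
  proof -
    have "(\<Sum>k\<in>K. \<phi> k * ?ind k \<omega>) = (\<Sum>k\<in>K. if Z \<omega> = k then \<phi> k else 0)"
      using that by (intro sum.cong) (auto simp: indicator_def)
    then show ?thesis using \<open>finite K\<close> Z[OF that] by simp
  qed
  have int: "integrable M (\<lambda>\<omega>. \<phi> k * ?ind k \<omega>)" if "k \<in> K" for k
    using ev[OF that] by (intro integrable_mult_right integrable_real_indicator) (auto simp: less_top[symmetric])
  have "integrable M (\<lambda>\<omega>. \<Sum>k\<in>K. \<phi> k * ?ind k \<omega>)"
    by (intro Bochner_Integration.integrable_sum int)
  then show "integrable M (\<lambda>\<omega>. \<phi> (Z \<omega>))"
    using eq by (subst Bochner_Integration.integrable_cong[OF refl eq]) auto
  have "(\<integral>\<omega>. \<phi> (Z \<omega>) \<partial>M) = (\<integral>\<omega>. (\<Sum>k\<in>K. \<phi> k * ?ind k \<omega>) \<partial>M)"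
    by (intro Bochner_Integration.integral_cong refl eq)
  also have "\<dots> = (\<Sum>k\<in>K. \<integral>\<omega>. \<phi> k * ?ind k \<omega> \<partial>M)"
    by (rule Bochner_Integration.integral_sum[OF int])
  also have "\<dots> = (\<Sum>k\<in>K. \<phi> k * prob {\<omega> \<in> space M. Z \<omega> = k})"
    using ev by (intro sum.cong refl) simp
  finally show "(\<integral>\<omega>. \<phi> (Z \<omega>) \<partial>M) = (\<Sum>k\<in>K. \<phi> k * prob {\<omega> \<in> space M. Z \<omega> = k})" .
qed

locale finite_markov_chain = prob_space M
  for M :: "'w measure" +
  fixes X :: "nat \<Rightarrow> 'w \<Rightarrow> 's::t1_space" and S :: "'s set" and n :: nat
  assumes markov: "finite_markov_process M X S n"
begin

definition determined_by :: "nat \<Rightarrow> ('w \<Rightarrow> 'b) \<Rightarrow> bool" where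
  "determined_by t F \<longleftrightarrow>
     (\<forall>\<omega>\<in>space M. \<forall>\<omega>'\<in>space M. (\<forall>s\<in>{1..t}. X s \<omega> = X s \<omega>') \<longrightarrow> F \<omega> = F \<omega>')"

definition history :: "nat \<Rightarrow> 'w \<Rightarrow> nat \<Rightarrow> 's" where
  "history t \<omega> = restrict (\<lambda>s. X s \<omega>) {1..t}"

abbreviation histories :: "nat \<Rightarrow> (nat \<Rightarrow> 's) set" where
  "histories t \<equiv> PiE {1..t} (\<lambda>_. S)"

lemma finite_states: "finite S"
  using markov by (simp add: finite_markov_process_def)

lemma state_in: "t \<in> {1..n} \<Longrightarrow> \<omega> \<in> space M \<Longrightarrow> X t \<omega> \<in> S"
  using markov by (simp add: finite_markov_process_def)

lemma state_event: "t \<in> {1..n} \<Longrightarrow> {\<omega> \<in> space M. X t \<omega> = x} \<in> events"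
  using markov measurable_sets[of "X t" M borel "{x}"]
  by (auto simp: finite_markov_process_def vimage_def Int_def conj_commute)

lemma finite_histories: "finite (histories t)"
  by (intro finite_PiE finite_states) auto

lemma history_in: "t \<le> n \<Longrightarrow> \<omega> \<in> space M \<Longrightarrow> history t \<omega> \<in> histories t"
  by (auto simp: history_def intro: state_in)

lemma history_eq_iff: "h \<in> histories t \<Longrightarrow> history t \<omega> = h \<longleftrightarrow> (\<forall>s\<in>{1..t}. X s \<omega> = h s)"
  unfolding history_def by (auto simp: restrict_def PiE_def extensional_def fun_eq_iff)

lemma history_event:
  assumes "t \<le> n" and "h \<in> histories t"
  shows "{\<omega> \<in> space M. history t \<omega> = h} \<in> events"
proof -
  have "{\<omega> \<in> space M. \<forall>s\<in>{1..t}. X s \<omega> = h s} \<in> events"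
    using assms(1) by (intro sets.sets_Collect_finite_All state_event) auto
  then show ?thesis using history_eq_iff[OF assms(2)] by simp
qed

lemma determined_by_obtains_function:
  assumes "determined_by t F"
  obtains \<phi> where "\<And>\<omega>. \<omega> \<in> space M \<Longrightarrow> F \<omega> = \<phi> (history t \<omega>)"
proof
  fix \<omega> assume \<omega>: "\<omega> \<in> space M"
  define \<omega>' where "\<omega>' = (SOME \<omega>'. \<omega>' \<in> space M \<and> history t \<omega>' = history t \<omega>)"
  have *: "\<omega>' \<in> space M \<and> history t \<omega>' = history t \<omega>"
    unfolding \<omega>'_def by (rule someI[of _ \<omega>]) (use \<omega> in auto)
  have "X s \<omega> = X s \<omega>'" if "s \<in> {1..t}" for s
    using * that unfolding history_def by (metis restrict_apply')
  then have "F \<omega> = F \<omega>'" using assms \<omega> * unfolding determined_by_def by blast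
  then show "F \<omega> = (\<lambda>h. F (SOME \<omega>'. \<omega>' \<in> space M \<and> history t \<omega>' = h)) (history t \<omega>)"
    by (simp add: \<omega>'_def)
qed

lemma integrable_determined_by:
  fixes F :: "'w \<Rightarrow> real"
  assumes "determined_by t F" and "t \<le> n"
  shows "integrable M F"
proof -
  obtain \<phi> where \<phi>: "\<And>\<omega>. \<omega> \<in> space M \<Longrightarrow> F \<omega> = \<phi> (history t \<omega>)"
    using determined_by_obtains_function[OF assms(1)] by metis
  have "integrable M (\<lambda>\<omega>. \<phi> (history t \<omega>))"
    by (rule expectation_finite_valued(1)[OF finite_histories history_in[OF assms(2)]
          history_event[OF assms(2)]])
  then show ?thesis using Bochner_Integration.integrable_cong[of M M F "\<lambda>\<omega>. \<phi> (history t \<omega>)"] \<phi> by simp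
qed

section \<open>The Markov property for decisions that depend on the past\<close>

text \<open>
  The transition probabilities out of the whole past reduce to those out of the current state, on
  each of the finitely many histories; a history of probability \<open>0\<close> contributes nothing to either
  side, which covers the arbitrary value of a conditional probability there.
\<close>

lemma prob_history_step:
  assumes t: "t \<in> {1..<n}" and h: "h \<in> histories t"
  shows "prob {\<omega> \<in> space M. (history t \<omega>, X (t + 1) \<omega>) = (h, y)} =
    \<P>(\<omega> in M. X (t + 1) \<omega> = y \<bar> X t \<omega> = h t) * prob {\<omega> \<in> space M. history t \<omega> = h}"
proof -
  let ?H = "{\<omega> \<in> space M. history t \<omega> = h}"
  have H: "?H = {\<omega> \<in> space M. \<forall>s\<in>{1..t}. X s \<omega> = h s}"
    using history_eq_iff[OF h] by simp
  have joint: "{\<omega> \<in> space M. (history t \<omega>, X (t + 1) \<omega>) = (h, y)} =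
      {\<omega> \<in> space M. X (t + 1) \<omega> = y \<and> (\<forall>s\<in>{1..t}. X s \<omega> = h s)}"
    using history_eq_iff[OF h] by auto
  show ?thesis
  proof (cases "prob ?H > 0")
    case True
    then have "\<P>(\<omega> in M. X (t + 1) \<omega> = y \<bar> \<forall>s\<in>{1..t}. X s \<omega> = h s) =
        \<P>(\<omega> in M. X (t + 1) \<omega> = y \<bar> X t \<omega> = h t)"
      using markov t unfolding finite_markov_process_def H by blast
    then show ?thesis
      using True unfolding cond_prob_def[of M _ "\<lambda>\<omega>. \<forall>s\<in>{1..t}. X s \<omega> = h s"] joint H
      by (simp add: field_simps)
  next
    case False
    then have "prob ?H = 0" using measure_nonneg[of M ?H] by linarith
    moreover have "prob {\<omega> \<in> space M. (history t \<omega>, X (t + 1) \<omega>) = (h, y)} \<le> prob ?H"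
      using t h by (intro finite_measure_mono history_event) auto
    ultimately show ?thesis
      by (simp add: measure_le_0_iff)
  qed
qed

lemma markov_expectation:
  fixes G :: "'b \<Rightarrow> 's \<Rightarrow> real"
  assumes t: "t \<in> {1..<n}" and v: "determined_by t v"
  shows "(\<integral>\<omega>. G (v \<omega>) (X (t + 1) \<omega>) \<partial>M) =
    (\<integral>\<omega>. (\<Sum>y\<in>S. G (v \<omega>) y * \<P>(\<omega>' in M. X (t + 1) \<omega>' = y \<bar> X t \<omega>' = X t \<omega>)) \<partial>M)"
proof -
  obtain \<phi> where \<phi>: "\<And>\<omega>. \<omega> \<in> space M \<Longrightarrow> v \<omega> = \<phi> (history t \<omega>)"
    using determined_by_obtains_function[OF v] by metis
  let ?p = "\<lambda>y x. \<P>(\<omega>' in M. X (t + 1) \<omega>' = y \<bar> X t \<omega>' = x)"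
  let ?pair = "\<lambda>\<omega>. (history t \<omega>, X (t + 1) \<omega>)"
  have tn: "t \<le> n" "t + 1 \<in> {1..n}" using t by auto
  have ev: "{\<omega> \<in> space M. ?pair \<omega> = k} \<in> events" if "k \<in> histories t \<times> S" for k
  proof -
    have "{\<omega> \<in> space M. ?pair \<omega> = k} =
        {\<omega> \<in> space M. history t \<omega> = fst k} \<inter> {\<omega> \<in> space M. X (t + 1) \<omega> = snd k}"
      by (cases k) auto
    moreover have "{\<omega> \<in> space M. history t \<omega> = fst k} \<in> events"
      using that tn by (intro history_event) auto
    ultimately show ?thesis using state_event[OF tn(2), of "snd k"] by simp
  qed
  have "(\<integral>\<omega>. G (v \<omega>) (X (t + 1) \<omega>) \<partial>M) = (\<integral>\<omega>. (\<lambda>(h, y). G (\<phi> h) y) (?pair \<omega>) \<partial>M)"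
    by (intro Bochner_Integration.integral_cong) (simp_all add: \<phi>)
  also have "\<dots> = (\<Sum>k\<in>histories t \<times> S.
      (\<lambda>(h, y). G (\<phi> h) y) k * prob {\<omega> \<in> space M. ?pair \<omega> = k})"
  proof (rule expectation_finite_valued(2)[OF _ _ ev])
    show "finite (histories t \<times> S)" using finite_histories finite_states by blast
    show "?pair \<omega> \<in> histories t \<times> S" if "\<omega> \<in> space M" for \<omega>
      using that tn history_in state_in by blast
  qed
  also have "\<dots> = (\<Sum>h\<in>histories t. \<Sum>y\<in>S. G (\<phi> h) y * prob {\<omega> \<in> space M. ?pair \<omega> = (h, y)})"
    by (subst sum.cartesian_product) (auto intro!: sum.cong)
  also have "\<dots> = (\<Sum>h\<in>histories t.
      (\<Sum>y\<in>S. G (\<phi> h) y * ?p y (h t)) * prob {\<omega> \<in> space M. history t \<omega> = h})"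
    unfolding sum_distrib_right using prob_history_step[OF t] by (intro sum.cong refl) simp
  also have "\<dots> = (\<integral>\<omega>. (\<lambda>h. \<Sum>y\<in>S. G (\<phi> h) y * ?p y (h t)) (history t \<omega>) \<partial>M)"
    using tn by (intro expectation_finite_valued(2)[symmetric] finite_histories history_in history_event)
  also have "\<dots> = (\<integral>\<omega>. (\<Sum>y\<in>S. G (v \<omega>) y * ?p y (X t \<omega>)) \<partial>M)"
    using t by (intro Bochner_Integration.integral_cong) (simp_all add: \<phi> history_def)
  finally show ?thesis .
qed

lemma AE_state_possible:
  assumes "t \<in> {1..n}"
  shows "AE \<omega> in M. prob {\<omega>' \<in> space M. X t \<omega>' = X t \<omega>} > 0"
proof -
  have "AE \<omega> in M. X t \<omega> = x \<longrightarrow> prob {\<omega>' \<in> space M. X t \<omega>' = x} > 0" for x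
  proof (cases "prob {\<omega>' \<in> space M. X t \<omega>' = x} > 0")
    case False
    then have "prob {\<omega>' \<in> space M. X t \<omega>' = x} = 0"
      using measure_nonneg[of M "{\<omega>' \<in> space M. X t \<omega>' = x}"] by linarith
    then have "AE \<omega> in M. \<omega> \<notin> {\<omega>' \<in> space M. X t \<omega>' = x}"
      using prob_eq_0[OF state_event[OF assms, of x]] by simp
    then show ?thesis by (rule AE_mp) auto
  qed simp
  then have "AE \<omega> in M. \<forall>x\<in>S. X t \<omega> = x \<longrightarrow> prob {\<omega>' \<in> space M. X t \<omega>' = x} > 0"
    by (intro AE_finite_allI finite_states)
  then show ?thesis
    by (rule AE_mp) (use state_in[OF assms] in \<open>auto intro!: AE_I2\<close>)
qed

lemma sum_transition_probs:
  assumes t: "t \<in> {1..n}" and s: "s \<in> {1..n}" and pos: "prob {\<omega> \<in> space M. X s \<omega> = x} > 0"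
  shows "(\<Sum>y\<in>S. \<P>(\<omega> in M. X t \<omega> = y \<bar> X s \<omega> = x)) = 1"
proof -
  let ?B = "{\<omega> \<in> space M. X s \<omega> = x}"
  have "prob ?B = (\<Sum>y\<in>S. prob ({\<omega> \<in> space M. X t \<omega> = y} \<inter> ?B))"
  proof (subst finite_measure_finite_Union[symmetric])
    show "prob ?B = prob (\<Union>y\<in>S. {\<omega> \<in> space M. X t \<omega> = y} \<inter> ?B)"
      using state_in[OF t] by (intro arg_cong[where f = prob]) auto
  qed (use finite_states state_event[OF t] state_event[OF s] in \<open>auto simp: disjoint_family_on_def\<close>)
  also have "\<dots> = (\<Sum>y\<in>S. prob {\<omega> \<in> space M. X t \<omega> = y \<and> X s \<omega> = x})"
    by (intro sum.cong arg_cong[where f = prob]) auto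
  finally show ?thesis
    using pos unfolding cond_prob_def sum_divide_distrib[symmetric] by simp
qed

lemma cond_expect_state:
  fixes F :: "'s \<Rightarrow> real"
  assumes t: "t \<in> {1..n}" and s: "s \<in> {1..n}"
  shows "cond_expect M (\<lambda>\<omega>. F (X t \<omega>)) (\<lambda>\<omega>. X s \<omega> = x) =
    (\<Sum>y\<in>S. F y * \<P>(\<omega> in M. X t \<omega> = y \<bar> X s \<omega> = x))"
proof -
  let ?pair = "\<lambda>\<omega>. (X t \<omega>, X s \<omega>)"
  have ev: "{\<omega> \<in> space M. ?pair \<omega> = k} \<in> events" for k
  proof -
    have "{\<omega> \<in> space M. ?pair \<omega> = k} =
        {\<omega> \<in> space M. X t \<omega> = fst k} \<inter> {\<omega> \<in> space M. X s \<omega> = snd k}"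
      by (cases k) auto
    then show ?thesis using state_event[OF t] state_event[OF s] by simp
  qed
  have "(\<integral>\<omega>. F (X t \<omega>) * of_bool (X s \<omega> = x) \<partial>M) =
      (\<integral>\<omega>. (\<lambda>(y, z). F y * of_bool (z = x)) (?pair \<omega>) \<partial>M)"
    by simp
  also have "\<dots> = (\<Sum>k\<in>S \<times> insert x S.
      (\<lambda>(y, z). F y * of_bool (z = x)) k * prob {\<omega> \<in> space M. ?pair \<omega> = k})"
    by (rule expectation_finite_valued(2)[OF _ _ ev])
      (use finite_states state_in[OF t] state_in[OF s] in auto)
  also have "\<dots> = (\<Sum>y\<in>S. \<Sum>z\<in>insert x S.
      F y * of_bool (z = x) * prob {\<omega> \<in> space M. ?pair \<omega> = (y, z)})"
    by (subst sum.cartesian_product) (auto intro!: sum.cong)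
  also have "\<dots> = (\<Sum>y\<in>S. F y * prob {\<omega> \<in> space M. ?pair \<omega> = (y, x)})"
  proof (intro sum.cong refl)
    fix y
    have "(\<Sum>z\<in>insert x S. F y * of_bool (z = x) * prob {\<omega> \<in> space M. ?pair \<omega> = (y, z)}) =
        (\<Sum>z\<in>insert x S. if z = x then F y * prob {\<omega> \<in> space M. ?pair \<omega> = (y, z)} else 0)"
      by (intro sum.cong) auto
    then show "(\<Sum>z\<in>insert x S. F y * of_bool (z = x) * prob {\<omega> \<in> space M. ?pair \<omega> = (y, z)}) =
        F y * prob {\<omega> \<in> space M. ?pair \<omega> = (y, x)}"
      using finite_states by (subst (asm) sum.delta) auto
  qed
  finally show ?thesis
    unfolding cond_expect_def cond_prob_def by (simp add: sum_divide_distrib)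
qed

end

section \<open>Decomposition of the expected cost\<close>

text \<open>
  With \<open>g\<close> the cost to go after day \<open>t\<close>, the expected cost from day \<open>t\<close> on of decision \<open>v\<close> in state
  \<open>x\<close>, after the previous decision \<open>u\<close>. For \<open>v, u \<in> {0, 1}\<close> these are the two sides of the minimum in
  the recursion for \<open>h\<close>; one formula for all reals matches the form of the cost function.
\<close>

definition action_value ::
  "'w measure \<Rightarrow> (nat \<Rightarrow> 'w \<Rightarrow> 's) \<Rightarrow> 's psps \<Rightarrow> nat \<Rightarrow> (real \<Rightarrow> 's \<Rightarrow> real) \<Rightarrow>
   real \<Rightarrow> real \<Rightarrow> 's \<Rightarrow> real" where
  "action_value M X P t g v u x =
     (revenue_loss P (t + 1) + lost_load P) * v
     + cond_expect M (\<lambda>\<omega>. fire_cost P (t + 1) * risk P (t + 1) (X (t + 1) \<omega>)) (\<lambda>\<omega>. X t \<omega> = x) * (1 - v)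
     + max (deenergize_cost P (t + 1) * (v - u)) (reenergize_cost P (t + 1) * (u - v))
     + g v x"

locale psps_problem = finite_markov_chain M X S "horizon P + 1"
  for M :: "'w measure" and X :: "nat \<Rightarrow> 'w \<Rightarrow> 's::t1_space" and S :: "'s set" and P :: "'s psps" +
  assumes valid: "valid_psps P"
begin

abbreviation T :: nat where "T \<equiv> horizon P"

abbreviation Q :: "nat \<Rightarrow> (real \<Rightarrow> 's \<Rightarrow> real) \<Rightarrow> real \<Rightarrow> real \<Rightarrow> 's \<Rightarrow> real" where
  "Q \<equiv> action_value M X P"

lemma horizon_pos: "T \<ge> 1"
  using valid by (simp add: valid_psps_def)

lemma costs_pos:
  assumes "t \<in> {1..T}"
  shows "fire_cost P (t + 1) > 0" "deenergize_cost P (t + 1) > 0" "reenergize_cost P (t + 1) > 0"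
proof -
  have "t + 1 \<in> {2..T + 1}" using assms by auto
  then show "fire_cost P (t + 1) > 0" "deenergize_cost P (t + 1) > 0" "reenergize_cost P (t + 1) > 0"
    using valid unfolding valid_psps_def by blast+
qed

lemma determined_by_decision:
  assumes "admissible M X P u" and "t \<le> T" and "t \<le> m"
  shows "determined_by m (u t)"
proof (cases "t = 0")
  case True
  then show ?thesis using assms(1) by (auto simp: admissible_def determined_by_def)
next
  case False
  then have "t \<in> {1..T}" using assms by auto
  then have "determined_by t (u t)"
    using assms(1) unfolding admissible_def determined_by_def by blast
  moreover have "{1..t} \<subseteq> {1..m}" using assms(3) by auto
  ultimately show ?thesis unfolding determined_by_def by blast
qed

lemma decision_binary:
  "admissible M X P u \<Longrightarrow> t \<le> T \<Longrightarrow> \<omega> \<in> space M \<Longrightarrow> u t \<omega> \<in> {0, 1}"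
proof (cases "t = 0")
  case False
  assume "admissible M X P u" "t \<le> T" "\<omega> \<in> space M"
  moreover have "t \<in> {1..T}" using False \<open>t \<le> T\<close> by simp
  ultimately show ?thesis unfolding admissible_def by blast
qed (simp add: admissible_def)

text \<open>Integrability reduces to this: everything that occurs depends on finitely many observations.\<close>

lemma integrable_of_observations:
  fixes F :: "real \<Rightarrow> real \<Rightarrow> 's \<Rightarrow> 's \<Rightarrow> real"
  assumes u: "admissible M X P u" and t: "t \<in> {1..T}"
  shows "integrable M (\<lambda>\<omega>. F (u t \<omega>) (u (t - 1) \<omega>) (X t \<omega>) (X (t + 1) \<omega>))"
proof (rule integrable_determined_by)
  have *: "determined_by (t + 1) (u t)" "determined_by (t + 1) (u (t - 1))"
    using t by (auto intro!: determined_by_decision[OF u])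
  show "determined_by (t + 1) (\<lambda>\<omega>. F (u t \<omega>) (u (t - 1) \<omega>) (X t \<omega>) (X (t + 1) \<omega>))"
    unfolding determined_by_def
  proof (intro ballI impI)
    fix \<omega> \<omega>' assume "\<omega> \<in> space M" "\<omega>' \<in> space M" and eq: "\<forall>s\<in>{1..t + 1}. X s \<omega> = X s \<omega>'"
    then have "u t \<omega> = u t \<omega>'" "u (t - 1) \<omega> = u (t - 1) \<omega>'"
      using * unfolding determined_by_def by blast+
    moreover have "X t \<omega> = X t \<omega>'" "X (t + 1) \<omega> = X (t + 1) \<omega>'"
      using t by (auto intro!: eq[rule_format])
    ultimately show "F (u t \<omega>) (u (t - 1) \<omega>) (X t \<omega>) (X (t + 1) \<omega>) =
        F (u t \<omega>') (u (t - 1) \<omega>') (X t \<omega>') (X (t + 1) \<omega>')"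
      by (simp only:)
  qed
qed (use t in auto)

lemma expected_stage_cost:
  assumes u: "admissible M X P u" and t: "t \<in> {1..T}"
  shows "(\<integral>\<omega>. (revenue_loss P (t + 1) * u t \<omega>
        + fire_cost P (t + 1) * risk P (t + 1) (X (t + 1) \<omega>) * (1 - u t \<omega>)
        + max (deenergize_cost P (t + 1) * (u t \<omega> - u (t - 1) \<omega>))
              (reenergize_cost P (t + 1) * (u (t - 1) \<omega> - u t \<omega>))
        + lost_load P * u t \<omega>) \<partial>M) =
    (\<integral>\<omega>. Q t g (u t \<omega>) (u (t - 1) \<omega>) (X t \<omega>) \<partial>M) - (\<integral>\<omega>. g (u t \<omega>) (X t \<omega>) \<partial>M)"
    (is "?lhs = _")
proof -
  note int = integrable_of_observations[OF u t]
  let ?f = "\<lambda>y. fire_cost P (t + 1) * risk P (t + 1) y"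
  let ?R = "\<lambda>\<omega>. (revenue_loss P (t + 1) + lost_load P) * u t \<omega>
        + max (deenergize_cost P (t + 1) * (u t \<omega> - u (t - 1) \<omega>))
              (reenergize_cost P (t + 1) * (u (t - 1) \<omega> - u t \<omega>))"
  let ?C = "\<lambda>x. cond_expect M (\<lambda>\<omega>. ?f (X (t + 1) \<omega>)) (\<lambda>\<omega>. X t \<omega> = x)"
  have int_R: "integrable M ?R"
    by (rule int[of "\<lambda>v w x y. (revenue_loss P (t + 1) + lost_load P) * v
        + max (deenergize_cost P (t + 1) * (v - w)) (reenergize_cost P (t + 1) * (w - v))"])
  have int_f: "integrable M (\<lambda>\<omega>. ?f (X (t + 1) \<omega>) * (1 - u t \<omega>))"
    by (rule int[of "\<lambda>v w x y. ?f y * (1 - v)"])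
  have int_C: "integrable M (\<lambda>\<omega>. ?C (X t \<omega>) * (1 - u t \<omega>))"
    by (rule int[of "\<lambda>v w x y. ?C x * (1 - v)"])
  have int_Q: "integrable M (\<lambda>\<omega>. Q t g (u t \<omega>) (u (t - 1) \<omega>) (X t \<omega>))"
    by (rule int[of "\<lambda>v w x y. Q t g v w x"])
  have int_g: "integrable M (\<lambda>\<omega>. g (u t \<omega>) (X t \<omega>))"
    by (rule int[of "\<lambda>v w x y. g v x"])
  have C: "?C x = (\<Sum>y\<in>S. ?f y * \<P>(\<omega> in M. X (t + 1) \<omega> = y \<bar> X t \<omega> = x))" for x
    using t by (intro cond_expect_state) auto
  have "(\<integral>\<omega>. ?f (X (t + 1) \<omega>) * (1 - u t \<omega>) \<partial>M) = (\<integral>\<omega>. ?C (X t \<omega>) * (1 - u t \<omega>) \<partial>M)"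
  proof -
    have "t \<in> {1..<T + 1}" "determined_by t (u t)"
      using t determined_by_decision[OF u] by auto
    from markov_expectation[OF this, of "\<lambda>v y. ?f y * (1 - v)"]
    show ?thesis unfolding C sum_distrib_right by (simp add: mult_ac)
  qed
  then have "?lhs = (\<integral>\<omega>. ?R \<omega> \<partial>M) + (\<integral>\<omega>. ?C (X t \<omega>) * (1 - u t \<omega>) \<partial>M)"
    using Bochner_Integration.integral_add[OF int_R int_f] by (simp add: algebra_simps)
  also have "\<dots> = (\<integral>\<omega>. Q t g (u t \<omega>) (u (t - 1) \<omega>) (X t \<omega>) - g (u t \<omega>) (X t \<omega>) \<partial>M)"
    using Bochner_Integration.integral_add[OF int_R int_C]
    by (simp add: action_value_def algebra_simps)
  also have "\<dots> = (\<integral>\<omega>. Q t g (u t \<omega>) (u (t - 1) \<omega>) (X t \<omega>) \<partial>M) - (\<integral>\<omega>. g (u t \<omega>) (X t \<omega>) \<partial>M)"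
    by (rule Bochner_Integration.integral_diff[OF int_Q int_g])
  finally show ?thesis .
qed

text \<open>
  The equation is demanded on states of positive probability only, since the transition
  probabilities out of the other states do not sum to \<open>1\<close>.
\<close>

definition bellman_pair :: "(nat \<Rightarrow> real \<Rightarrow> 's \<Rightarrow> real) \<Rightarrow> (nat \<Rightarrow> real \<Rightarrow> 's \<Rightarrow> real) \<Rightarrow> bool" where
  "bellman_pair g W \<longleftrightarrow>
     (\<forall>v x. g T v x = 0) \<and>
     (\<forall>t\<in>{1..<T}. \<forall>v\<in>{0, 1}. \<forall>x. prob {\<omega> \<in> space M. X t \<omega> = x} > 0 \<longrightarrow>
        g t v x = (\<Sum>y\<in>S. W (t + 1) v y * \<P>(\<omega> in M. X (t + 1) \<omega> = y \<bar> X t \<omega> = x)))"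

lemma expected_cost_to_go:
  assumes u: "admissible M X P u" and gW: "bellman_pair g W" and t: "t \<in> {1..<T}"
  shows "(\<integral>\<omega>. g t (u t \<omega>) (X t \<omega>) \<partial>M) = (\<integral>\<omega>. W (t + 1) (u t \<omega>) (X (t + 1) \<omega>) \<partial>M)"
proof -
  let ?E = "\<lambda>\<omega>. \<Sum>y\<in>S. W (t + 1) (u t \<omega>) y * \<P>(\<omega>' in M. X (t + 1) \<omega>' = y \<bar> X t \<omega>' = X t \<omega>)"
  have t': "t \<in> {1..T}" "t \<in> {1..<T + 1}" "t \<in> {1..T + 1}" using t by auto
  note int = integrable_of_observations[OF u t'(1)]
  have "integrable M (\<lambda>\<omega>. g t (u t \<omega>) (X t \<omega>))"
    by (rule int[of "\<lambda>v w x y. g t v x"])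
  moreover have "integrable M ?E"
    by (rule int[of "\<lambda>v w x z. \<Sum>y\<in>S. W (t + 1) v y * \<P>(\<omega>' in M. X (t + 1) \<omega>' = y \<bar> X t \<omega>' = x)"])
  moreover have "AE \<omega> in M. g t (u t \<omega>) (X t \<omega>) = ?E \<omega>"
    using AE_state_possible[OF t'(3)] AE_space
  proof eventually_elim
    case (elim \<omega>)
    then have "u t \<omega> \<in> {0, 1}" using decision_binary[OF u] t by auto
    then show ?case using elim gW t unfolding bellman_pair_def by blast
  qed
  ultimately have "(\<integral>\<omega>. g t (u t \<omega>) (X t \<omega>) \<partial>M) = (\<integral>\<omega>. ?E \<omega> \<partial>M)"
    by (intro integral_cong_AE) auto
  also have "\<dots> = (\<integral>\<omega>. W (t + 1) (u t \<omega>) (X (t + 1) \<omega>) \<partial>M)"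
    using t'(1) by (intro markov_expectation[symmetric] t'(2) determined_by_decision[OF u]) auto
  finally show ?thesis .
qed

text \<open>
  The values \<open>W\<close> telescope: what is expected after one day is what is expected at the start of the
  next one. What remains of a policy is its regret relative to \<open>W\<close> on each day.
\<close>

lemma expected_cost_decomposition:
  assumes u: "admissible M X P u" and gW: "bellman_pair g W"
  shows "(\<integral>\<omega>. adjusted_cost P X u \<omega> \<partial>M) =
    (\<integral>\<omega>. W 1 0 (X 1 \<omega>) \<partial>M)
    + (\<Sum>t=1..T. \<integral>\<omega>. (Q t (g t) (u t \<omega>) (u (t - 1) \<omega>) (X t \<omega>) - W t (u (t - 1) \<omega>) (X t \<omega>)) \<partial>M)
    - lost_load P * real (budget P) + investment P (budget P)"
proof -
  let ?c = "\<lambda>t \<omega>. revenue_loss P (t + 1) * u t \<omega>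
        + fire_cost P (t + 1) * risk P (t + 1) (X (t + 1) \<omega>) * (1 - u t \<omega>)
        + max (deenergize_cost P (t + 1) * (u t \<omega> - u (t - 1) \<omega>))
              (reenergize_cost P (t + 1) * (u (t - 1) \<omega> - u t \<omega>))
        + lost_load P * u t \<omega>"
  let ?K = "investment P (budget P) - lost_load P * real (budget P)"
  define q where "q t = (\<integral>\<omega>. Q t (g t) (u t \<omega>) (u (t - 1) \<omega>) (X t \<omega>) \<partial>M)" for t
  define e where "e t = (\<integral>\<omega>. g t (u t \<omega>) (X t \<omega>) \<partial>M)" for t
  define w where "w t = (\<integral>\<omega>. W t (u (t - 1) \<omega>) (X t \<omega>) \<partial>M)" for t
  note int = integrable_of_observations[OF u]
  have int_c: "integrable M (?c t)" if "t \<in> {1..T}" for t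
    by (rule int[OF that, of "\<lambda>v w x y. revenue_loss P (t + 1) * v
        + fire_cost P (t + 1) * risk P (t + 1) y * (1 - v)
        + max (deenergize_cost P (t + 1) * (v - w)) (reenergize_cost P (t + 1) * (w - v))
        + lost_load P * v"])
  have "adjusted_cost P X u \<omega> = (\<Sum>t=1..T. ?c t \<omega>) + ?K" for \<omega>
    by (simp add: adjusted_cost_def sum.distrib sum_distrib_left right_diff_distrib)
  then have "(\<integral>\<omega>. adjusted_cost P X u \<omega> \<partial>M) = (\<integral>\<omega>. (\<Sum>t=1..T. ?c t \<omega>) + ?K \<partial>M)"
    by (simp only:)
  also have "\<dots> = (\<integral>\<omega>. (\<Sum>t=1..T. ?c t \<omega>) \<partial>M) + (\<integral>\<omega>. ?K \<partial>M)"
    by (intro Bochner_Integration.integral_add Bochner_Integration.integrable_sum int_c) simp_all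
  also have "(\<integral>\<omega>. (\<Sum>t=1..T. ?c t \<omega>) \<partial>M) = (\<Sum>t=1..T. \<integral>\<omega>. ?c t \<omega> \<partial>M)"
    by (rule Bochner_Integration.integral_sum[OF int_c])
  also have "\<dots> = (\<Sum>t=1..T. q t - e t)"
    unfolding q_def e_def by (intro sum.cong refl expected_stage_cost[OF u])
  also have "(\<Sum>t=1..T. q t - e t) = w 1 + (\<Sum>t=1..T. q t - w t)"
  proof -
    have "(\<Sum>t=1..T. e t) = (\<Sum>t=1..<T. e t) + e T"
      using sum.last_plus[of 1 T e] horizon_pos by simp
    also have "e T = 0" using gW by (simp add: e_def bellman_pair_def)
    also have "(\<Sum>t=1..<T. e t) = (\<Sum>t=1..<T. w (Suc t))"
      by (intro sum.cong refl) (simp add: e_def w_def expected_cost_to_go[OF u gW, simplified])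
    also have "\<dots> = (\<Sum>t=1..T. w t) - w 1"
      using horizon_pos sum.atLeast_Suc_atMost[of 1 T w] sum.shift_bounds_Suc_ivl[of w 1 T]
      by (simp add: atLeastLessThanSuc_atLeastAtMost)
    finally show ?thesis by (simp add: sum_subtractf)
  qed
  also have "(\<Sum>t=1..T. q t - w t) =
      (\<Sum>t=1..T. \<integral>\<omega>. (Q t (g t) (u t \<omega>) (u (t - 1) \<omega>) (X t \<omega>) - W t (u (t - 1) \<omega>) (X t \<omega>)) \<partial>M)"
    unfolding q_def w_def
  proof (intro sum.cong refl Bochner_Integration.integral_diff[symmetric])
    fix t assume t: "t \<in> {1..T}"
    show "integrable M (\<lambda>\<omega>. Q t (g t) (u t \<omega>) (u (t - 1) \<omega>) (X t \<omega>))"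
      by (rule int[OF t, of "\<lambda>v w x y. Q t (g t) v w x"])
    show "integrable M (\<lambda>\<omega>. W t (u (t - 1) \<omega>) (X t \<omega>))"
      by (rule int[OF t, of "\<lambda>v w x y. W t w x"])
  qed
  also have "w 1 = (\<integral>\<omega>. W 1 0 (X 1 \<omega>) \<partial>M)"
    unfolding w_def using u
    by (intro Bochner_Integration.integral_cong) (auto simp: admissible_def)
  finally show ?thesis by (simp add: prob_space)
qed

theorem optimal_if_greedy:
  assumes F: "\<And>u. F u \<Longrightarrow> admissible M X P u" and gW: "bellman_pair g W" and "F opt"
    and lower: "\<And>u t \<omega>. F u \<Longrightarrow> t \<in> {1..T} \<Longrightarrow> \<omega> \<in> space M \<Longrightarrow>
      W t (u (t - 1) \<omega>) (X t \<omega>) \<le> Q t (g t) (u t \<omega>) (u (t - 1) \<omega>) (X t \<omega>)"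
    and greedy: "\<And>t \<omega>. t \<in> {1..T} \<Longrightarrow> \<omega> \<in> space M \<Longrightarrow>
      Q t (g t) (opt t \<omega>) (opt (t - 1) \<omega>) (X t \<omega>) = W t (opt (t - 1) \<omega>) (X t \<omega>)"
  shows "is_arg_min (\<lambda>u. \<integral>\<omega>. adjusted_cost P X u \<omega> \<partial>M) F opt"
proof -
  let ?reg = "\<lambda>u. \<Sum>t=1..T. \<integral>\<omega>. (Q t (g t) (u t \<omega>) (u (t - 1) \<omega>) (X t \<omega>) - W t (u (t - 1) \<omega>) (X t \<omega>)) \<partial>M"
  have nonneg: "?reg u \<ge> 0" if "F u" for u
    using lower[OF that] by (intro sum_nonneg integral_nonneg_AE AE_I2) simp
  have "(\<integral>\<omega>. (Q t (g t) (opt t \<omega>) (opt (t - 1) \<omega>) (X t \<omega>) - W t (opt (t - 1) \<omega>) (X t \<omega>)) \<partial>M) = 0"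
    if "t \<in> {1..T}" for t
    by (rule integral_eq_zero_AE, rule AE_I2) (simp add: greedy[OF that, simplified])
  then have "?reg opt = 0" by (intro sum.neutral) blast
  then have "(\<integral>\<omega>. adjusted_cost P X opt \<omega> \<partial>M) \<le> (\<integral>\<omega>. adjusted_cost P X u \<omega> \<partial>M)" if "F u" for u
    using expected_cost_decomposition[OF F[OF that] gW] nonneg[OF that]
      expected_cost_decomposition[OF F[OF \<open>F opt\<close>] gW] by linarith
  then show ?thesis using \<open>F opt\<close> by (auto simp: is_arg_min_def not_less)
qed

section \<open>The recursion and the threshold rule\<close>

lemma action_value_0:
  assumes "t \<in> {1..T}" and "u \<in> {0, 1}"
  shows "Q t g 0 u x = g 0 x
    + cond_expect M (\<lambda>\<omega>. fire_cost P (t + 1) * risk P (t + 1) (X (t + 1) \<omega>)) (\<lambda>\<omega>. X t \<omega> = x)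
    + u * reenergize_cost P (t + 1)"
  using costs_pos[OF assms(1)] assms(2) by (auto simp: action_value_def)

lemma action_value_1:
  assumes "t \<in> {1..T}" and "u \<in> {0, 1}"
  shows "Q t g 1 u x = g 1 x + revenue_loss P (t + 1) + lost_load P + (1 - u) * deenergize_cost P (t + 1)"
  using costs_pos[OF assms(1)] assms(2) by (auto simp: action_value_def)

lemma dp_step_eq:
  assumes "t \<in> {1..T}" and "u \<in> {0, 1}"
  shows "dp_step M X S P t g u x =
    (\<Sum>y\<in>S. min (Q t g 0 u y) (Q t g 1 u y) * \<P>(\<omega> in M. X t \<omega> = y \<bar> X (t - 1) \<omega> = x))"
  unfolding dp_step_def action_value_0[OF assms] action_value_1[OF assms] ..

text \<open>
  Multiplied by the wildfire cost, the threshold inequality compares the two sides of the minimum;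
  a tie goes to the shutoff.
\<close>

lemma threshold_rule_greedy:
  assumes t: "t \<in> {1..T}" and u: "u \<in> {0, 1}"
  shows "Q t g (threshold_rule M X P t g u x) u x = min (Q t g 0 u x) (Q t g 1 u x)"
proof -
  let ?A = "fire_cost P (t + 1)"
  let ?E = "cond_expect M (\<lambda>\<omega>. risk P (t + 1) (X (t + 1) \<omega>)) (\<lambda>\<omega>. X t \<omega> = x)"
  let ?B = "g 1 x - g 0 x + revenue_loss P (t + 1) + lost_load P
            + (1 - u) * deenergize_cost P (t + 1) - u * reenergize_cost P (t + 1)"
  have E: "cond_expect M (\<lambda>\<omega>. ?A * risk P (t + 1) (X (t + 1) \<omega>)) (\<lambda>\<omega>. X t \<omega> = x) = ?A * ?E"
    by (simp add: cond_expect_def mult.assoc)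
  have "1 / ?A * ?B \<le> ?E \<longleftrightarrow> ?B \<le> ?A * ?E"
    using costs_pos(1)[OF t] by (simp add: field_simps)
  also have "\<dots> \<longleftrightarrow> Q t g 1 u x \<le> Q t g 0 u x"
    unfolding action_value_0[OF t u] action_value_1[OF t u] E by linarith
  finally show ?thesis by (simp add: threshold_rule_def min_def)
qed

text \<open>
  The cost to go after day \<open>t\<close>, by calendar day. On day \<open>t < T\<close> it is \<open>h\<close> with \<open>T - t - 1\<close> remaining
  days, because \<open>h\<^sub>0\<close> already contains the stage of day \<open>T\<close>.
\<close>

definition cost_after :: "(real \<Rightarrow> 's \<Rightarrow> real) \<Rightarrow> nat \<Rightarrow> real \<Rightarrow> 's \<Rightarrow> real" where
  "cost_after b t = (if t < T then cost_to_go M X S P b (T - t - 1) else (\<lambda>_ _. 0))"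

definition free_value :: "(real \<Rightarrow> 's \<Rightarrow> real) \<Rightarrow> nat \<Rightarrow> real \<Rightarrow> 's \<Rightarrow> real" where
  "free_value b t u x = min (Q t (cost_after b t) 0 u x) (Q t (cost_after b t) 1 u x)"

lemma cost_after_step:
  assumes "t \<ge> 1" and "t + 1 < T" and "v \<in> {0, 1}"
  shows "cost_after b t v x =
    (\<Sum>y\<in>S. free_value b (t + 1) v y * \<P>(\<omega> in M. X (t + 1) \<omega> = y \<bar> X t \<omega> = x))"
proof -
  have d: "T - t - 1 = Suc (T - (t + 1) - 1)" "T - Suc (T - (t + 1) - 1) = t + 1"
    using assms(2) by auto
  have "cost_after b t = cost_to_go M X S P b (Suc (T - (t + 1) - 1))"
    using assms(2) unfolding cost_after_def d(1) by simp
  also have "\<dots> = dp_step M X S P (t + 1) (cost_after b (t + 1))"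
    using assms(2) unfolding cost_to_go.simps d(2) by (simp add: cost_after_def)
  finally show ?thesis
    using dp_step_eq[of "t + 1" v "cost_after b (t + 1)" x] assms by (simp add: free_value_def)
qed

lemma free_value_le:
  "v \<in> {0, 1} \<Longrightarrow> free_value b t u x \<le> Q t (cost_after b t) v u x"
  by (auto simp: free_value_def)

section \<open>Optimality with a free last decision\<close>

lemma bellman_pair_free:
  "bellman_pair (cost_after (h0_free M X S P)) (free_value (h0_free M X S P))"
  unfolding bellman_pair_def
proof (intro conjI ballI allI impI)
  fix t v x assume t: "t \<in> {1..<T}" and v: "v \<in> {0, 1 :: real}"
  let ?b = "h0_free M X S P"
  show "cost_after ?b t v x =
    (\<Sum>y\<in>S. free_value ?b (t + 1) v y * \<P>(\<omega> in M. X (t + 1) \<omega> = y \<bar> X t \<omega> = x))"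
  proof (cases "t + 1 < T")
    case True
    then show ?thesis using t v by (intro cost_after_step) auto
  next
    case False
    then have T: "T = t + 1" using t by auto
    then have "cost_after ?b t = ?b" "cost_after ?b T = (\<lambda>_ _. 0)" by (simp_all add: cost_after_def)
    then show ?thesis
      using dp_step_eq[of T v "\<lambda>_ _. 0" x] horizon_pos v T by (simp add: h0_free_def free_value_def)
  qed
qed (simp add: cost_after_def)

lemma policy_free_Suc:
  assumes "t \<in> {1..T}"
  shows "policy_free M X S P t \<omega> =
    threshold_rule M X P t (cost_after (h0_free M X S P) t) (policy_free M X S P (t - 1) \<omega>) (X t \<omega>)"
  using assms by (cases t) (auto simp: cost_after_def)

lemma policy_free_binary: "policy_free M X S P t \<omega> \<in> {0, 1}"
  by (cases t) (auto simp: threshold_rule_def)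

lemma policy_free_admissible: "admissible M X P (policy_free M X S P)"
proof -
  have "policy_free M X S P t \<omega> = policy_free M X S P t \<omega>'"
    if "\<forall>s\<in>{1..t}. X s \<omega> = X s \<omega>'" for t \<omega> \<omega>'
    using that by (induction t) auto
  then show ?thesis
    using policy_free_binary unfolding admissible_def by auto
qed

lemma policy_free_optimal:
  "is_arg_min (\<lambda>u. \<integral>\<omega>. adjusted_cost P X u \<omega> \<partial>M) (admissible M X P) (policy_free M X S P)"
proof (rule optimal_if_greedy[where F = "admissible M X P", OF _ bellman_pair_free policy_free_admissible])
  fix u t \<omega> assume "admissible M X P u" "t \<in> {1..T}" "\<omega> \<in> space M"
  then show "free_value (h0_free M X S P) t (u (t - 1) \<omega>) (X t \<omega>)
      \<le> Q t (cost_after (h0_free M X S P) t) (u t \<omega>) (u (t - 1) \<omega>) (X t \<omega>)"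
    using decision_binary[of u t \<omega>] by (intro free_value_le) auto
next
  fix t \<omega> assume "t \<in> {1..T}"
  then show "Q t (cost_after (h0_free M X S P) t) (policy_free M X S P t \<omega>)
      (policy_free M X S P (t - 1) \<omega>) (X t \<omega>) =
    free_value (h0_free M X S P) t (policy_free M X S P (t - 1) \<omega>) (X t \<omega>)"
    unfolding policy_free_Suc[OF \<open>t \<in> {1..T}\<close>] free_value_def
    by (intro threshold_rule_greedy policy_free_binary)
qed

section \<open>Optimality when the grid must be energized at the end\<close>

definition energized_value :: "nat \<Rightarrow> real \<Rightarrow> 's \<Rightarrow> real" where
  "energized_value t u x =
     (if t < T then free_value (h0_energized M X S P) t u x else Q t (\<lambda>_ _. 0) 0 u x)"

lemma bellman_pair_energized:
  "bellman_pair (cost_after (h0_energized M X S P)) energized_value"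
  unfolding bellman_pair_def
proof (intro conjI ballI allI impI)
  fix t v x assume t: "t \<in> {1..<T}" and v: "v \<in> {0, 1 :: real}"
    and pos: "prob {\<omega> \<in> space M. X t \<omega> = x} > 0"
  let ?b = "h0_energized M X S P"
  show "cost_after ?b t v x =
    (\<Sum>y\<in>S. energized_value (t + 1) v y * \<P>(\<omega> in M. X (t + 1) \<omega> = y \<bar> X t \<omega> = x))"
  proof (cases "t + 1 < T")
    case True
    then show ?thesis using t v cost_after_step[of t v ?b x] by (simp add: energized_value_def)
  next
    case False
    then have T: "T = t + 1" using t by auto
    let ?C = "\<lambda>y. cond_expect M (\<lambda>\<omega>. fire_cost P (T + 1) * risk P (T + 1) (X (T + 1) \<omega>)) (\<lambda>\<omega>. X T \<omega> = y)"
    let ?p = "\<lambda>y. \<P>(\<omega> in M. X T \<omega> = y \<bar> X t \<omega> = x)"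
    have Q0: "energized_value T v y = ?C y + v * reenergize_cost P (T + 1)" for y
      using horizon_pos v action_value_0[of T v "\<lambda>_ _. 0" y] by (simp add: energized_value_def)
    \<comment> \<open>The switching cost stands outside the sum in \<open>h\<^sub>0\<close>; it moves inside because \<open>?p\<close> sums to \<open>1\<close>.\<close>
    have "(\<Sum>y\<in>S. ?p y) = 1"
      using t pos T by (intro sum_transition_probs) auto
    then have "(\<Sum>y\<in>S. energized_value T v y * ?p y) =
        (\<Sum>y\<in>S. ?C y * ?p y) + v * reenergize_cost P (T + 1)"
      unfolding Q0 distrib_right sum.distrib sum_distrib_left[symmetric] by simp
    also have "\<dots> = ?b v x"
      using T by (simp add: h0_energized_def)
    also have "\<dots> = cost_after ?b t v x" using T by (simp add: cost_after_def)
    finally show ?thesis using T by simp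
  qed
qed (simp add: cost_after_def)

lemma policy_energized_Suc:
  assumes "t \<in> {1..<T}"
  shows "policy_energized M X S P t \<omega> =
    threshold_rule M X P t (cost_after (h0_energized M X S P) t)
      (policy_energized M X S P (t - 1) \<omega>) (X t \<omega>)"
  using assms by (cases t) (auto simp: cost_after_def)

lemma policy_energized_last: "t \<ge> T \<Longrightarrow> policy_energized M X S P t \<omega> = 0"
  by (cases t) auto

lemma policy_energized_binary: "policy_energized M X S P t \<omega> \<in> {0, 1}"
  by (cases t) (auto simp: threshold_rule_def)

lemma policy_energized_admissible: "admissible M X P (policy_energized M X S P)"
proof -
  have "policy_energized M X S P t \<omega> = policy_energized M X S P t \<omega>'"
    if "\<forall>s\<in>{1..t}. X s \<omega> = X s \<omega>'" for t \<omega> \<omega>'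
    using that by (induction t) auto
  then show ?thesis
    using policy_energized_binary policy_energized_last unfolding admissible_def by auto
qed

lemma policy_energized_optimal:
  "is_arg_min (\<lambda>u. \<integral>\<omega>. adjusted_cost P X u \<omega> \<partial>M)
     (\<lambda>u. admissible M X P u \<and> energized_after M P u) (policy_energized M X S P)"
proof (rule optimal_if_greedy[OF _ bellman_pair_energized])
  show "admissible M X P (policy_energized M X S P) \<and> energized_after M P (policy_energized M X S P)"
    using policy_energized_admissible policy_energized_last by (simp add: energized_after_def)
next
  fix u t \<omega>
  assume u: "admissible M X P u \<and> energized_after M P u" and t: "t \<in> {1..T}" and \<omega>: "\<omega> \<in> space M"
  show "energized_value t (u (t - 1) \<omega>) (X t \<omega>)
      \<le> Q t (cost_after (h0_energized M X S P) t) (u t \<omega>) (u (t - 1) \<omega>) (X t \<omega>)"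
  proof (cases "t < T")
    case True
    then show ?thesis
      using u \<omega> decision_binary[of u t \<omega>] by (auto simp: energized_value_def intro!: free_value_le)
  next
    case False
    then have "t = T" using t by simp
    then show ?thesis
      using u \<omega> by (simp add: energized_value_def cost_after_def energized_after_def)
  qed
next
  fix t \<omega> assume t: "t \<in> {1..T}"
  show "Q t (cost_after (h0_energized M X S P) t) (policy_energized M X S P t \<omega>)
      (policy_energized M X S P (t - 1) \<omega>) (X t \<omega>) =
    energized_value t (policy_energized M X S P (t - 1) \<omega>) (X t \<omega>)"
  proof (cases "t < T")
    case True
    then have t': "t \<in> {1..<T}" using t by simp
    show ?thesis
      unfolding policy_energized_Suc[OF t'] energized_value_def free_value_def
      using True t threshold_rule_greedy[OF t policy_energized_binary] by simp
  next
    case False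
    then show ?thesis
      using policy_energized_last[of t] by (simp add: energized_value_def cost_after_def)
  qed
qed auto

end

theorem proposition2:
  fixes M :: "'w measure"
    and X :: "nat \<Rightarrow> 'w \<Rightarrow> real ^ 'n"
    and S :: "(real ^ 'n) set"
    and P :: "(real ^ 'n) psps"
  assumes "prob_space M"
    and "valid_psps P"
    and "finite_markov_process M X S (horizon P + 1)"
  shows "is_arg_min (\<lambda>u. \<integral>\<omega>. adjusted_cost P X u \<omega> \<partial>M)
           (\<lambda>u. admissible M X P u \<and> energized_after M P u)
           (policy_energized M X S P) \<and>
         is_arg_min (\<lambda>u. \<integral>\<omega>. adjusted_cost P X u \<omega> \<partial>M)
           (admissible M X P)
           (policy_free M X S P)"
proof -
  interpret prob_space M by (rule assms(1))
  interpret psps_problem M X S P by unfold_locales (rule assms)+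
  show ?thesis using policy_energized_optimal policy_free_optimal by blast
qed

end
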